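(* Let $K\subset\mathbb R^m$ be a smooth cone and $h:\mathbb R^n\to\mathbb R^m$ a continuously differentiable $K$-concave function, and let $S=\{x\in\mathbb R^n:h(x)\in K\}$ be nonempty. Then the inclusion $h(x)\in K$ has a local error bound at $\bar x\in S$ if and only if there exists a neighborhood $U$ of $\bar x$ such that $\mathrm{ACQ}(S\cap U)$ holds, i.e. $$h'(x)^*[N_K(h(x))]=N_S(x)\quad\text{for all }x\in S\cap U.$$
   Context: $h$ is $K$-concave if $h((1-\lambda)x+\lambda y)-[(1-\lambda)h(x)+\lambda h(y)]\in K$ for all $x,y$, $\lambda\in[0,1]$. $h'(x)^*$ is the adjoint of the Jacobian. $N_D(x)$ is the normal cone of a convex set $D$ at $x$. The inclusion has a local error bound at $\bar x\in S$ if there exist a neighborhood $U$ of $\bar x$ and $\alpha>0$ with $d(x,S)\le\alpha\, d(h(x),K)$ for all $x\in U$, where $d(x,D)=\inf_{y\in D}\|x-y\|$. A cone is regular if pointed, closed, convex, with nonempty interior. A regular cone $C$ is smooth if every boundary point of $C$ lies on an extreme ray of $C$ (a ray $\{\lambda x:\lambda\ge0\}$, $x\ne0$, which is a face of $C$, a face being a convex $\mathcal F\subset C$ such that $x,y\in C$, $\lambda x+(1-\lambda)y\in\mathcal F$ for some $0<\lambda<1$ implies $x,y\in\mathcal F$) and, for every non-zero point $x$ of any extreme ray, $N_C(x)$ has dimension one. *)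

theory Defs
  imports "HOL-Analysis.Analysis"
begin

definition normal_cone :: "'a::real_inner set \<Rightarrow> 'a \<Rightarrow> 'a set" where
  "normal_cone D x = {v. \<forall>y\<in>D. inner v (y - x) \<le> 0}"

definition K_concave :: "'b::real_vector set \<Rightarrow> ('a::real_vector \<Rightarrow> 'b) \<Rightarrow> bool" where
  "K_concave K h \<longleftrightarrow>
     (\<forall>x y. \<forall>t\<in>{0..1::real}.
        h ((1 - t) *\<^sub>R x + t *\<^sub>R y) - ((1 - t) *\<^sub>R h x + t *\<^sub>R h y) \<in> K)"

definition regular_cone :: "'a::euclidean_space set \<Rightarrow> bool" where
  "regular_cone C \<longleftrightarrow> cone C \<and> C \<inter> uminus ` C = {0} \<and> closed C \<and> convex C
     \<and> interior C \<noteq> {}"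

definition ray :: "'a::real_vector \<Rightarrow> 'a set" where
  "ray x = {t *\<^sub>R x | t. t \<ge> (0::real)}"

definition extreme_ray :: "'a::real_vector set \<Rightarrow> 'a set \<Rightarrow> bool" where
  "extreme_ray C R \<longleftrightarrow> (\<exists>x. x \<noteq> 0 \<and> R = ray x \<and> R face_of C)"

definition smooth_cone :: "'a::euclidean_space set \<Rightarrow> bool" where
  "smooth_cone C \<longleftrightarrow> regular_cone C
     \<and> (\<forall>z\<in>frontier C. \<exists>R. extreme_ray C R \<and> z \<in> R)
     \<and> (\<forall>R. extreme_ray C R \<longrightarrow> (\<forall>x\<in>R. x \<noteq> 0 \<longrightarrow> dim (normal_cone C x) = 1))"

definition local_error_bound ::
  "('a::real_normed_vector \<Rightarrow> 'b::real_normed_vector) \<Rightarrow> 'b set \<Rightarrow> 'a \<Rightarrow> bool" where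
  "local_error_bound h K xbar \<longleftrightarrow>
     (\<exists>U \<alpha>. open U \<and> xbar \<in> U \<and> \<alpha> > 0 \<and>
        (\<forall>x\<in>U. infdist x {y. h y \<in> K} \<le> \<alpha> * infdist (h x) K))"

end

theory Submission
  imports Defs
begin

text \<open>
  If the error bound holds near \<open>x \<in> S\<close> and \<open>v \<in> N\<^sub>S(x)\<close>, then
  \<open>t \<langle>v, u\<rangle> \<le> \<parallel>v\<parallel> d(x + tu, S) \<le> \<alpha> \<parallel>v\<parallel> d(h(x + tu), K)\<close>. The last distance equals
  \<open>\<langle>n, h(x + tu)\<rangle>\<close> for a unit normal \<open>n\<close> at the projection onto \<open>K\<close>; letting \<open>t\<close> tend to 0 yields
  \<open>n \<in> N\<^sub>K(h(x))\<close> in the unit ball with \<open>\<langle>v, u\<rangle> \<le> \<alpha> \<parallel>v\<parallel> \<langle>n, h'(x)u\<rangle>\<close>. As \<open>u\<close> is arbitrary, \<open>v\<close> cannot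
  be separated from the image under \<open>h'(x)\<^sup>*\<close> of a ball in \<open>N\<^sub>K(h(x))\<close>.

  Conversely, suppose the error bound fails along points \<open>x\<^sub>k\<close> tending to \<open>xbar\<close>, with projections \<open>s\<^sub>k\<close>
  onto \<open>S\<close> and unit normals \<open>v\<^sub>k\<close> in the direction of \<open>x\<^sub>k - s\<^sub>k\<close>. Concavity gives
  \<open>\<langle>n, h'(s\<^sub>k)v\<^sub>k\<rangle> \<le> \<parallel>n\<parallel> / k\<close> for all \<open>n \<in> N\<^sub>K(h(s\<^sub>k))\<close>. Write \<open>v\<^sub>k = h'(s\<^sub>k)\<^sup>* m\<^sub>k\<close> by ACQ; the limit \<open>n\<^sub>0\<close> of
  the normalised \<open>m\<^sub>k\<close> then satisfies \<open>h'(xbar)\<^sup>* n\<^sub>0 = 0\<close>, so the convex function \<open>\<langle>n\<^sub>0, h\<rangle>\<close> is minimal on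
  all of \<open>S\<close> and \<open>h'(s\<^sub>k)\<^sup>* n\<^sub>0 = 0\<close>. If \<open>h(s\<^sub>k) \<noteq> 0\<close>, smoothness of \<open>K\<close> makes \<open>m\<^sub>k\<close> a multiple of \<open>n\<^sub>0\<close>, which
  is absurd as \<open>v\<^sub>k \<noteq> 0\<close>. So \<open>h(s\<^sub>k) = 0 = h(xbar)\<close>, and the limit \<open>v\<^sub>0\<close> of the \<open>v\<^sub>k\<close> is
  \<open>h'(xbar)\<^sup>* q\<close> with \<open>q\<close> normal to \<open>K\<close> at 0; the same estimate with \<open>n = q\<close> gives
  \<open>\<parallel>v\<^sub>0\<parallel>\<^sup>2 \<le> 0\<close>, a contradiction.
\<close>

section \<open>Normal cones\<close>

lemma normal_cone_of_cone_iff: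
  assumes "cone K" "w \<in> K"
  shows "n \<in> normal_cone K w \<longleftrightarrow> (\<forall>k\<in>K. n \<bullet> k \<le> 0) \<and> n \<bullet> w = 0"
proof
  assume n: "n \<in> normal_cone K w"
  \<comment> \<open>Testing \<open>n\<close> against these two points bounds
    \<open>n \<bullet> w\<close> from both sides by 0.\<close>
  have "0 \<in> K" and "2 *\<^sub>R w \<in> K"
    using assms cone_contains_0 mem_cone by (blast, simp add: mem_cone)
  with n have "n \<bullet> (0 - w) \<le> 0" "n \<bullet> (2 *\<^sub>R w - w) \<le> 0"
    unfolding normal_cone_def by blast+
  then have nw: "n \<bullet> w = 0"
    by (simp add: inner_diff_right)
  then show "(\<forall>k\<in>K. n \<bullet> k \<le> 0) \<and> n \<bullet> w = 0"
    using n by (simp add: normal_cone_def inner_diff_right)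
qed (simp add: normal_cone_def inner_diff_right)

text \<open>Closed graph of the normal cone map: base point and normal may both vary along the
  sequence.\<close>

lemma normal_cone_limit:
  assumes "\<And>k::nat. n k \<in> normal_cone D (p k)" "n \<longlonglongrightarrow> n0" "p \<longlonglongrightarrow> p0"
  shows "n0 \<in> normal_cone D p0"
  unfolding normal_cone_def
proof clarify
  fix y assume "y \<in> D"
  then have "\<And>k. n k \<bullet> (y - p k) \<le> 0"
    using assms(1) unfolding normal_cone_def by blast
  moreover have "(\<lambda>k. n k \<bullet> (y - p k)) \<longlonglongrightarrow> n0 \<bullet> (y - p0)"
    by (intro tendsto_intros assms)
  ultimately show "n0 \<bullet> (y - p0) \<le> 0"
    by (intro LIMSEQ_le_const2) auto
qed

lemma normal_cone_scaleR:
  assumes "n \<in> normal_cone D x" "c \<ge> 0"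
  shows "c *\<^sub>R n \<in> normal_cone D x"
  using assms by (simp add: normal_cone_def mult_nonneg_nonpos)

lemma convex_normal_cone: "convex (normal_cone D x)"
  unfolding convex_def normal_cone_def
  by (auto simp: inner_left_distrib intro!: add_nonpos_nonpos mult_nonneg_nonpos)

lemma closed_normal_cone: "closed (normal_cone D x)"
proof -
  have "normal_cone D x = (\<Inter>y\<in>D. {v. (y - x) \<bullet> v \<le> 0})"
    by (auto simp: normal_cone_def inner_commute)
  then show ?thesis
    by (simp add: closed_INT closed_halfspace_le)
qed

lemma inner_sgn_self: "v \<bullet> sgn v = norm v"
  by (cases "v = 0") (simp_all add: sgn_div_norm dot_square_norm power2_eq_square)

lemma normal_cone_interior:
  assumes "x \<in> interior D"
  shows "normal_cone D x \<subseteq> {0}"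
proof
  fix v assume v: "v \<in> normal_cone D x"
  obtain e where e: "e > 0" "cball x e \<subseteq> D"
    using assms mem_interior_cball by blast
  \<comment> \<open>\<open>sgn v\<close> is 0 for \<open>v = 0\<close>, so no case distinction
    arises.\<close>
  have "x + e *\<^sub>R sgn v \<in> D"
    using e by (intro subsetD[OF e(2)]) (auto simp: dist_norm norm_sgn)
  then have "v \<bullet> ((x + e *\<^sub>R sgn v) - x) \<le> 0"
    using v unfolding normal_cone_def by blast
  then have "e * (v \<bullet> sgn v) \<le> 0"
    by simp
  moreover have "v \<bullet> sgn v = norm v"
    by (rule inner_sgn_self)
  ultimately show "v \<in> {0}"
    using e(1) by (simp add: mult_le_0_iff)
qed

section \<open>Distances and projections\<close>

lemma infdist_closest_point:
  fixes D :: "'a::euclidean_space set"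
  assumes "closed D" "D \<noteq> {}"
  shows "infdist x D = norm (x - closest_point D x)"
proof (rule antisym)
  show "infdist x D \<le> norm (x - closest_point D x)"
    using infdist_le[OF closest_point_in_set[OF assms], of x] by (simp add: dist_norm)
  show "norm (x - closest_point D x) \<le> infdist x D"
    unfolding infdist_notempty[OF assms(2)]
    using assms closest_point_le[OF assms(1)]
    by (intro cINF_greatest) (auto simp: dist_norm[symmetric])
qed

lemma closest_point_normal:
  fixes D :: "'a::euclidean_space set"
  assumes "closed D" "convex D"
  shows "x - closest_point D x \<in> normal_cone D (closest_point D x)"
  unfolding normal_cone_def using closest_point_dot[OF assms(2,1)] by blast

text \<open>Subtracting any \<open>k \<in> K\<close> from \<open>w\<close> can only increase
  \<open>n \<bullet> w\<close>; Cauchy-Schwarz and the infimum over \<open>k\<close> do the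
  rest.\<close>

lemma inner_le_infdist_cone:
  assumes "K \<noteq> {}" "\<forall>k\<in>K. n \<bullet> k \<le> 0"
  shows "n \<bullet> w \<le> norm n * infdist w K"
proof (cases "n = 0")
  case False
  have "n \<bullet> w / norm n \<le> dist w k" if "k \<in> K" for k
  proof -
    have "n \<bullet> w = n \<bullet> (w - k) + n \<bullet> k"
      by (simp add: inner_diff_right)
    also have "\<dots> \<le> norm n * dist w k"
      using assms(2) that norm_cauchy_schwarz[of n "w - k"] by (fastforce simp: dist_norm)
    finally show ?thesis
      using False by (simp add: field_simps)
  qed
  then have "n \<bullet> w / norm n \<le> infdist w K"
    unfolding infdist_notempty[OF assms(1)] using assms(1) by (intro cINF_greatest) auto
  then show ?thesis
    using False by (simp add: field_simps)
qed simp

section \<open>Derivatives and K-concavity\<close>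

lemma has_derivative_LIMSEQ_quotient:
  fixes h :: "'a::real_normed_vector \<Rightarrow> 'b::real_normed_vector"
  assumes "(h has_derivative A) (at x)"
  shows "(\<lambda>k. real (Suc k) *\<^sub>R (h (x + inverse (real (Suc k)) *\<^sub>R u) - h x)) \<longlonglongrightarrow> A u"
proof -
  have A: "linear A"
    using assms has_derivative_linear by blast
  have "((\<lambda>t. x + t *\<^sub>R u) has_derivative (\<lambda>t. t *\<^sub>R u)) (at (0::real))"
    by (auto intro!: derivative_eq_intros)
  then have "((\<lambda>t. h (x + t *\<^sub>R u)) has_derivative (\<lambda>t. A (t *\<^sub>R u))) (at (0::real))"
    using has_derivative_compose[of "\<lambda>t. x + t *\<^sub>R u" _ 0 UNIV h A] assms by simp
  then have "((\<lambda>t. norm (h (x + t *\<^sub>R u) - h x - t *\<^sub>R A u) / norm t) \<longlongrightarrow> 0) (at (0::real))"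
    by (simp add: has_derivative_iff_norm linear_scale[OF A])
  moreover have "filterlim (\<lambda>k. inverse (real (Suc k))) (at 0) sequentially"
    unfolding filterlim_at using LIMSEQ_inverse_real_of_nat by (auto simp del: of_nat_Suc)
  ultimately have "(\<lambda>k. norm (h (x + inverse (real (Suc k)) *\<^sub>R u) - h x - inverse (real (Suc k)) *\<^sub>R A u)
      / norm (inverse (real (Suc k)))) \<longlonglongrightarrow> 0"
    by (rule filterlim_compose)
  moreover have "norm (h (x + inverse c *\<^sub>R u) - h x - inverse c *\<^sub>R A u) / norm (inverse c)
      = norm (c *\<^sub>R (h (x + inverse c *\<^sub>R u) - h x) - A u)" if "c > 0" for c :: real
  proof -
    have "c *\<^sub>R (h (x + inverse c *\<^sub>R u) - h x) - A u
        = c *\<^sub>R (h (x + inverse c *\<^sub>R u) - h x - inverse c *\<^sub>R A u)"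
      using that by (simp add: scaleR_diff_right)
    then show ?thesis
      using that by (simp add: divide_simps)
  qed
  ultimately have "(\<lambda>k. norm (real (Suc k) *\<^sub>R (h (x + inverse (real (Suc k)) *\<^sub>R u) - h x) - A u))
      \<longlonglongrightarrow> 0"
    by (simp del: of_nat_Suc)
  then show ?thesis
    using LIM_zero_cancel tendsto_norm_zero_iff by blast
qed

text \<open>Divide the concavity relation by \<open>t\<close> and let \<open>t\<close> tend to 0;
  closedness keeps the limit in \<open>K\<close>.\<close>

lemma K_concave_derivative:
  assumes "K_concave K h" "cone K" "closed K" "(h has_derivative A) (at x)"
  shows "A (y - x) - (h y - h x) \<in> K"
proof (rule closed_sequentially[OF assms(3)])
  let ?q = "\<lambda>k. real (Suc k) *\<^sub>R (h (x + inverse (real (Suc k)) *\<^sub>R (y - x)) - h x) - (h y - h x)"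
  show "?q \<longlonglongrightarrow> A (y - x) - (h y - h x)"
    by (intro tendsto_intros has_derivative_LIMSEQ_quotient assms)
  show "?q k \<in> K" for k
  proof -
    define t where "t = inverse (real (Suc k))"
    have t: "t \<in> {0..1}" "real (Suc k) * t = 1"
      by (simp_all add: t_def field_simps)
    have "h ((1 - t) *\<^sub>R x + t *\<^sub>R y) - ((1 - t) *\<^sub>R h x + t *\<^sub>R h y) \<in> K"
      using assms(1) t(1) unfolding K_concave_def by blast
    then have "real (Suc k) *\<^sub>R (h ((1 - t) *\<^sub>R x + t *\<^sub>R y) - ((1 - t) *\<^sub>R h x + t *\<^sub>R h y)) \<in> K"
      using assms(2) by (simp add: mem_cone)
    also have "(1 - t) *\<^sub>R x + t *\<^sub>R y = x + t *\<^sub>R (y - x)"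
      by (simp add: algebra_simps)
    also have "h (x + t *\<^sub>R (y - x)) - ((1 - t) *\<^sub>R h x + t *\<^sub>R h y)
        = (h (x + t *\<^sub>R (y - x)) - h x) - t *\<^sub>R (h y - h x)"
      by (simp add: algebra_simps)
    also have "real (Suc k) *\<^sub>R \<dots> = real (Suc k) *\<^sub>R (h (x + t *\<^sub>R (y - x)) - h x) - (h y - h x)"
      using t(2) by (simp only: scaleR_diff_right scaleR_scaleR scaleR_one)
    finally show ?thesis
      by (simp only: t_def)
  qed
qed

text \<open>Gradient inequality: \<open>n\<close> is nonpositive on \<open>K\<close>, so
  \<open>n \<bullet> h\<close> is convex, and it vanishes at \<open>s\<close>.\<close>

lemma normal_inner_derivative_le:
  assumes "K_concave K h" "cone K" "closed K" "(h has_derivative A) (at s)"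
    and "h s \<in> K" "n \<in> normal_cone K (h s)"
  shows "n \<bullet> A (x - s) \<le> n \<bullet> h x"
proof -
  have n: "\<forall>k\<in>K. n \<bullet> k \<le> 0" "n \<bullet> h s = 0"
    using assms normal_cone_of_cone_iff by blast+
  have "n \<bullet> (A (x - s) - (h x - h s)) \<le> 0"
    using n(1) K_concave_derivative[OF assms(1-4)] by blast
  then show ?thesis
    using n(2) by (simp add: inner_diff_right)
qed

lemma convex_K_concave_preimage:
  assumes "K_concave K h" "cone K" "convex K"
  shows "convex {x. h x \<in> K}"
  unfolding convex_alt
proof clarify
  fix x y and t :: real
  assume xy: "h x \<in> K" "h y \<in> K" and t: "0 \<le> t" "t \<le> 1"
  have "h ((1 - t) *\<^sub>R x + t *\<^sub>R y) - ((1 - t) *\<^sub>R h x + t *\<^sub>R h y) \<in> K"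
    using assms(1) t unfolding K_concave_def by auto
  moreover have "(1 - t) *\<^sub>R h x + t *\<^sub>R h y \<in> K"
    using assms(3) xy t unfolding convex_alt by blast
  ultimately have "(h ((1 - t) *\<^sub>R x + t *\<^sub>R y) - ((1 - t) *\<^sub>R h x + t *\<^sub>R h y))
      + ((1 - t) *\<^sub>R h x + t *\<^sub>R h y) \<in> K"
    using assms(2,3) convex_cone by blast
  then show "h ((1 - t) *\<^sub>R x + t *\<^sub>R y) \<in> K"
    by simp
qed

text \<open>The half of ACQ that follows from concavity: the gradient inequality bounds the pairing
  with \<open>y - x\<close> by \<open>n \<bullet> h y\<close>, which is at most 0 for feasible
  \<open>y\<close>.\<close>

lemma adjoint_image_normal_cone_subset:
  fixes h :: "'a::euclidean_space \<Rightarrow> 'b::euclidean_space"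
  assumes "K_concave K h" "cone K" "closed K" "(h has_derivative A) (at x)" "h x \<in> K"
  shows "adjoint A ` normal_cone K (h x) \<subseteq> normal_cone {x. h x \<in> K} x"
proof clarify
  fix n assume n: "n \<in> normal_cone K (h x)"
  have A: "linear A"
    using assms has_derivative_linear by blast
  have "n \<bullet> A (y - x) \<le> 0" if "h y \<in> K" for y
    using normal_inner_derivative_le[OF assms n, of y] n that assms(2,5)
    by (force simp: normal_cone_of_cone_iff)
  then show "adjoint A n \<in> normal_cone {x. h x \<in> K} x"
    by (simp add: normal_cone_def adjoint_works[OF A] inner_commute)
qed

section \<open>From the error bound to ACQ\<close>

lemma error_bound_directional_normal:
  fixes h :: "'a::euclidean_space \<Rightarrow> 'b::euclidean_space"
  assumes K: "cone K" "closed K" "convex K"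
    and der: "(h has_derivative A) (at x)"
    and S: "S = {x. h x \<in> K}" "closed S" "x \<in> S"
    and U: "open U" "x \<in> U" "0 \<le> \<alpha>" "\<And>x. x \<in> U \<Longrightarrow> infdist x S \<le> \<alpha> * infdist (h x) K"
    and v: "v \<in> normal_cone S x"
  obtains n where "n \<in> normal_cone K (h x)" "norm n \<le> 1" "v \<bullet> u \<le> \<alpha> * norm v * (n \<bullet> A u)"
proof -
  define t where "t k = inverse (real (Suc k))" for k
  define y where "y k = h (x + t k *\<^sub>R u)" for k
  define p where "p k = closest_point K (y k)" for k
  \<comment> \<open>If \<open>y k\<close> lies in \<open>K\<close>, then \<open>n k = 0\<close>;
    hence compactness is taken in the unit ball and not on the sphere.\<close>
  define n where "n k = sgn (y k - p k)" for k
  have t: "t k > 0" "real (Suc k) * t k = 1" for k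
    by (auto simp: t_def)
  have hx: "h x \<in> K" and Kne: "K \<noteq> {}"
    using S by auto
  have "t \<longlonglongrightarrow> 0"
    unfolding t_def by (rule LIMSEQ_inverse_real_of_nat)
  then have lx: "(\<lambda>k. x + t k *\<^sub>R u) \<longlonglongrightarrow> x"
    using tendsto_add[OF tendsto_const[of x] tendsto_scaleR[OF _ tendsto_const[of u]], of t 0]
    by simp
  have "isCont h x"
    using der has_derivative_continuous by blast
  then have ly: "y \<longlonglongrightarrow> h x"
    unfolding y_def using lx isCont_tendsto_compose by blast
  have lp: "p \<longlonglongrightarrow> h x"
    unfolding p_def
    using isCont_tendsto_compose[OF continuous_at_closest_point[OF K(3,2) Kne] ly]
      closest_point_self[OF hx] by simp
  have pK: "p k \<in> K" for k
    unfolding p_def using closest_point_in_set K(2) Kne by blast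
  have nN: "n k \<in> normal_cone K (p k)" for k
    unfolding n_def p_def sgn_div_norm
    by (intro normal_cone_scaleR closest_point_normal K) auto
  have bound: "v \<bullet> u \<le> \<alpha> * norm v * (n k \<bullet> (real (Suc k) *\<^sub>R (y k - h x)))"
    if k: "x + t k *\<^sub>R u \<in> U" for k
  proof -
    have nk: "n k \<bullet> p k = 0" "n k \<bullet> h x \<le> 0"
      using nN[of k] pK hx normal_cone_of_cone_iff[OF K(1)] by blast+
    let ?z = "x + t k *\<^sub>R u"
    let ?s = "closest_point S ?z"
    have "?s \<in> S"
      using closest_point_in_set S by blast
    then have "v \<bullet> (?s - x) \<le> 0"
      using v unfolding normal_cone_def by blast
    then have "t k * (v \<bullet> u) \<le> v \<bullet> (?z - ?s)"
      by (simp add: inner_diff_right inner_add_right)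
    also have "\<dots> \<le> norm v * infdist ?z S"
      using infdist_closest_point[OF S(2)] S(3) norm_cauchy_schwarz by fastforce
    also have "\<dots> \<le> norm v * (\<alpha> * infdist (y k) K)"
      unfolding y_def using U(4)[OF k] by (intro mult_left_mono) auto
    also have "infdist (y k) K = norm (y k - p k)"
      unfolding p_def by (rule infdist_closest_point[OF K(2) Kne])
    also have "\<dots> = n k \<bullet> (y k - p k)"
      unfolding n_def by (metis inner_sgn_self inner_commute)
    \<comment> \<open>Replacing \<open>p k\<close> by \<open>h x\<close> turns the distance into a
      difference quotient; the signs in \<open>nk\<close> allow it.\<close>
    also have "norm v * (\<alpha> * \<dots>) \<le> norm v * (\<alpha> * (n k \<bullet> (y k - h x)))"
      using nk U(3) by (intro mult_left_mono) (auto simp: inner_diff_right)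
    finally have "real (Suc k) * (t k * (v \<bullet> u))
        \<le> real (Suc k) * (norm v * (\<alpha> * (n k \<bullet> (y k - h x))))"
      by (rule mult_left_mono) simp
    then show ?thesis
      by (simp only: mult.assoc[symmetric] t mult_1 inner_scaleR_right) (simp add: mult_ac)
  qed
  have "n k \<in> cball 0 1" for k
    by (simp add: n_def norm_sgn)
  then obtain n0 r where n0: "n0 \<in> cball 0 1" and r: "strict_mono r" "(n \<circ> r) \<longlonglongrightarrow> n0"
    using compact_cball[of "0::'b" 1] unfolding compact_def by metis
  have ev: "\<forall>\<^sub>F k in sequentially. x + t (r k) *\<^sub>R u \<in> U"
    using LIMSEQ_subseq_LIMSEQ[OF lx r(1)] U(1,2) unfolding comp_def
    by (metis topological_tendstoD)
  have lq: "(\<lambda>k. real (Suc (r k)) *\<^sub>R (y (r k) - h x)) \<longlonglongrightarrow> A u"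
    using LIMSEQ_subseq_LIMSEQ[OF has_derivative_LIMSEQ_quotient[OF der, of u] r(1)]
    unfolding comp_def y_def t_def .
  show thesis
  proof
    show "n0 \<in> normal_cone K (h x)"
      using normal_cone_limit[of "n \<circ> r" K "p \<circ> r"] nN r LIMSEQ_subseq_LIMSEQ[OF lp r(1)] by auto
    show "norm n0 \<le> 1"
      using n0 by simp
    have "(\<lambda>k. \<alpha> * norm v * (n (r k) \<bullet> (real (Suc (r k)) *\<^sub>R (y (r k) - h x))))
        \<longlonglongrightarrow> \<alpha> * norm v * (n0 \<bullet> A u)"
      using r(2) lq by (intro tendsto_intros) (auto simp: comp_def)
    then show "v \<bullet> u \<le> \<alpha> * norm v * (n0 \<bullet> A u)"
      by (rule tendsto_lowerbound) (use ev bound in \<open>auto elim: eventually_mono\<close>)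
  qed
qed

text \<open>The normal found for a direction \<open>u\<close> depends on \<open>u\<close>;
  separation from a compact convex set yields one normal that serves all directions.\<close>

lemma error_bound_imp_normal_cone_subset:
  fixes h :: "'a::euclidean_space \<Rightarrow> 'b::euclidean_space"
  assumes K: "cone K" "closed K" "convex K"
    and der: "(h has_derivative A) (at x)"
    and S: "S = {x. h x \<in> K}" "closed S" "x \<in> S"
    and U: "open U" "x \<in> U" "0 \<le> \<alpha>" "\<And>x. x \<in> U \<Longrightarrow> infdist x S \<le> \<alpha> * infdist (h x) K"
  shows "normal_cone S x \<subseteq> adjoint A ` normal_cone K (h x)"
proof
  fix v assume v: "v \<in> normal_cone S x"
  \<comment> \<open>The radius is the factor of \<open>n\<close> in the directional estimate;
    truncating to a ball makes the image compact.\<close>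
  define Q where "Q = adjoint A ` (normal_cone K (h x) \<inter> cball 0 (\<alpha> * norm v))"
  have A: "linear A"
    using der has_derivative_linear by blast
  have A': "linear (adjoint A)"
    by (rule adjoint_linear[OF A])
  have "compact (normal_cone K (h x) \<inter> cball 0 (\<alpha> * norm v))"
    by (simp add: closed_Int_compact closed_normal_cone)
  then have "compact Q"
    unfolding Q_def by (intro compact_continuous_image linear_continuous_on)
      (auto simp: A' linear_conv_bounded_linear[symmetric])
  have "convex Q"
    unfolding Q_def by (intro convex_linear_image A' convex_Int convex_normal_cone convex_cball)
  have dominated: "\<exists>q\<in>Q. v \<bullet> u \<le> q \<bullet> u" for u
  proof -
    obtain n where n: "n \<in> normal_cone K (h x)" "norm n \<le> 1" "v \<bullet> u \<le> \<alpha> * norm v * (n \<bullet> A u)"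
      using error_bound_directional_normal[OF assms v] by blast
    let ?n = "(\<alpha> * norm v) *\<^sub>R n"
    have "?n \<in> normal_cone K (h x) \<inter> cball 0 (\<alpha> * norm v)"
      using n U(3) by (auto intro!: normal_cone_scaleR simp: abs_mult mult_left_le)
    then have "adjoint A ?n \<in> Q"
      unfolding Q_def by blast
    moreover have "adjoint A ?n \<bullet> u = \<alpha> * norm v * (n \<bullet> A u)"
      using adjoint_works[OF A, of u ?n] by (simp add: inner_commute)
    ultimately show ?thesis
      using n(3) by metis
  qed
  have "v \<in> Q"
  proof (rule ccontr)
    assume "v \<notin> Q"
    then obtain a b where ab: "a \<bullet> v < b" "\<forall>q\<in>Q. b < a \<bullet> q"
      using separating_hyperplane_closed_point[OF \<open>convex Q\<close> compact_imp_closed[OF \<open>compact Q\<close>]]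
      by blast
    \<comment> \<open>In direction \<open>- a\<close> the point \<open>v\<close> lies strictly above
      all of \<open>Q\<close>, contrary to \<open>dominated\<close>.\<close>
    obtain q where "q \<in> Q" "v \<bullet> (- a) \<le> q \<bullet> (- a)"
      using dominated[of "- a"] by blast
    with ab show False
      by (force simp: inner_commute)
  qed
  then show "v \<in> adjoint A ` normal_cone K (h x)"
    unfolding Q_def by blast
qed

section \<open>From ACQ to the error bound\<close>

lemma smooth_cone_normals_parallel:
  assumes "smooth_cone K" "w \<in> K" "w \<noteq> 0" "n \<in> normal_cone K w" "m \<in> normal_cone K w" "n \<noteq> 0"
  obtains c where "m = c *\<^sub>R n"
proof -
  have "closed K"
    using assms(1) unfolding smooth_cone_def regular_cone_def by blast
  \<comment> \<open>A nonzero normal forces \<open>w\<close> to the boundary, hence onto an extreme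
    ray, where the normals span a line.\<close>
  moreover have "w \<notin> interior K"
    using normal_cone_interior assms(4,6) by blast
  ultimately have "w \<in> frontier K"
    using assms(2) by (simp add: frontier_def)
  then have d: "dim (normal_cone K w) = 1"
    using assms(1,3) unfolding smooth_cone_def by blast
  have "{n} \<subseteq> span (normal_cone K w)" "independent {n}"
    using assms(4,6) by (auto simp: span_base)
  then have "span (normal_cone K w) \<subseteq> span {n}"
    using d card_ge_dim_independent[of "{n}" "span (normal_cone K w)"] by simp
  then have "m \<in> span {n}"
    using assms(5) span_base by blast
  then show thesis
    using that by (auto simp: span_singleton)
qed

lemma normal_cone_subset_imp_error_bound:
  fixes h :: "'a::euclidean_space \<Rightarrow> 'b::euclidean_space"
    and h' :: "'a \<Rightarrow> ('a \<Rightarrow>\<^sub>L 'b)"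
  assumes smooth: "smooth_cone K"
    and der: "\<And>x. (h has_derivative blinfun_apply (h' x)) (at x)"
    and h'_cont: "continuous_on UNIV h'"
    and conc: "K_concave K h"
    and S: "S = {x. h x \<in> K}" "closed S" "convex S" "xbar \<in> S"
    and U: "open U" "xbar \<in> U"
    and ACQ: "\<And>x. x \<in> S \<inter> U \<Longrightarrow> normal_cone S x \<subseteq> adjoint (h' x) ` normal_cone K (h x)"
  shows "local_error_bound h K xbar"
proof (rule ccontr)
  assume no_bound: "\<not> local_error_bound h K xbar"
  have K: "cone K" "closed K" "convex K"
    using smooth unfolding smooth_cone_def regular_cone_def by auto
  have Kne: "K \<noteq> {}" and Sne: "S \<noteq> {}"
    using S by auto
  have hS: "h x \<in> K" if "x \<in> S" for x
    using that S(1) by simp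
  have adj: "adjoint (h' x) n \<bullet> u = n \<bullet> h' x u" for x n u
    using adjoint_works[of "h' x" u n] der has_derivative_linear by (metis inner_commute)
  obtain e where e: "e > 0" "ball xbar e \<subseteq> U"
    using U open_contains_ball by blast
  \<comment> \<open>The bound fails for constant \<open>k + 1\<close> on the ball of radius
    \<open>e / (k + 1)\<close>.\<close>
  have ex: "\<exists>x. dist xbar x < e / real (Suc k) \<and> infdist x S > real (Suc k) * infdist (h x) K" for k
  proof (rule ccontr)
    assume "\<not> ?thesis"
    then have "\<forall>x\<in>ball xbar (e / real (Suc k)). infdist x S \<le> real (Suc k) * infdist (h x) K"
      by (meson mem_ball not_less)
    then show False
      using no_bound e(1) unfolding local_error_bound_def S(1)
      by (auto dest!: spec[of _ "ball xbar (e / real (Suc k))"] spec[of _ "real (Suc k)"])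
  qed
  obtain x where x: "\<And>k. dist xbar (x k) < e / real (Suc k)"
      "\<And>k. infdist (x k) S > real (Suc k) * infdist (h (x k)) K"
    using choice[of "\<lambda>k x. dist xbar x < e / real (Suc k) \<and>
        infdist x S > real (Suc k) * infdist (h x) K"] ex by blast
  define s where "s k = closest_point S (x k)" for k
  have sS: "s k \<in> S" for k
    unfolding s_def using closest_point_in_set S(2) Sne by blast
  \<comment> \<open>Projection is nonexpansive and fixes \<open>xbar\<close>, so \<open>s k\<close>
    is as close to \<open>xbar\<close> as \<open>x k\<close>.\<close>
  have ds: "dist xbar (s k) < e / real (Suc k)" for k
    using closest_point_lipschitz[OF S(3,2) Sne, of xbar "x k"] x(1)[of k]
    by (simp add: s_def closest_point_self[OF S(4)])
  have "e / real (Suc k) \<le> e" for k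
    using e(1) by (simp add: field_simps)
  then have sU: "s k \<in> S \<inter> U" for k
    using ds[of k] e(2) sS[of k] by (meson IntI less_le_trans mem_ball subsetD)
  have "(\<lambda>k. e / real (Suc k)) \<longlonglongrightarrow> 0"
    using LIMSEQ_Suc[OF lim_const_over_n[of e]] by simp
  then have "(\<lambda>k. dist (s k) xbar) \<longlonglongrightarrow> 0"
    by (rule Lim_null_comparison[rotated])
      (use ds in \<open>auto simp: dist_commute less_imp_le simp del: of_nat_Suc\<close>)
  then have ls: "s \<longlonglongrightarrow> xbar"
    using tendsto_dist_iff by blast
  define v where "v k = sgn (x k - s k)" for k
  have inf: "infdist (x k) S = norm (x k - s k)" for k
    unfolding s_def by (rule infdist_closest_point[OF S(2) Sne])
  have pos: "norm (x k - s k) > 0" for k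
    using x(2)[of k] infdist_nonneg[of "h (x k)" K] unfolding inf
    by (smt (verit) mult_nonneg_nonneg of_nat_0_le_iff)
  have v1: "norm (v k) = 1" for k
    using pos[of k] by (simp add: v_def norm_sgn)
  have vN: "v k \<in> normal_cone S (s k)" for k
    unfolding v_def s_def sgn_div_norm
    by (intro normal_cone_scaleR closest_point_normal S) auto
  \<comment> \<open>The gradient inequality at \<open>s k\<close> meets the failed bound at
    \<open>x k\<close>; the factor \<open>norm (x k - s k)\<close> cancels.\<close>
  have small: "n \<bullet> h' (s k) (v k) \<le> norm n * inverse (real (Suc k))"
    if n: "n \<in> normal_cone K (h (s k))" for n k
  proof -
    have np: "\<forall>k\<in>K. n \<bullet> k \<le> 0"
      using n normal_cone_of_cone_iff K(1) hS[OF sS] by blast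
    have xs: "x k - s k = norm (x k - s k) *\<^sub>R v k"
      using pos[of k] by (simp add: v_def sgn_div_norm)
    have "norm (x k - s k) * (n \<bullet> h' (s k) (v k)) = n \<bullet> h' (s k) (x k - s k)"
      by (subst (2) xs) (simp only: blinfun.scaleR_right inner_scaleR_right)
    also have "\<dots> \<le> n \<bullet> h (x k)"
      by (rule normal_inner_derivative_le[OF conc K(1,2) der hS[OF sS] n])
    also have "\<dots> \<le> norm n * infdist (h (x k)) K"
      by (rule inner_le_infdist_cone[OF Kne np])
    also have "\<dots> \<le> norm n * (norm (x k - s k) * inverse (real (Suc k)))"
      using x(2)[of k] unfolding inf
      by (intro mult_left_mono) (auto simp: field_simps)
    finally have "norm (x k - s k) * (n \<bullet> h' (s k) (v k))
        \<le> norm (x k - s k) * (norm n * inverse (real (Suc k)))"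
      by (simp add: mult_ac)
    then show ?thesis
      using pos[of k] mult_le_cancel_left_pos by blast
  qed
  have "\<exists>m\<in>normal_cone K (h (s k)). v k = adjoint (h' (s k)) m" for k
    using ACQ[OF sU] vN by blast
  then obtain m where mN: "\<And>k. m k \<in> normal_cone K (h (s k))"
      and m: "\<And>k. v k = adjoint (h' (s k)) (m k)"
    by metis
  have m_inner: "m k \<bullet> h' (s k) u = v k \<bullet> u" for k u
    unfolding m adj ..
  have m0: "m k \<noteq> 0" for k
    using m_inner[of k "v k"] v1[of k] by auto
  define n where "n k = sgn (m k)" for k
  have nN: "n k \<in> normal_cone K (h (s k))" for k
    unfolding n_def sgn_div_norm by (intro normal_cone_scaleR mN) auto
  have n1: "norm (n k) = 1" for k
    using m0 by (simp add: n_def norm_sgn)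
  have n_inner: "n k \<bullet> h' (s k) u = inverse (norm (m k)) * (v k \<bullet> u)" for k u
    by (simp add: n_def sgn_div_norm m_inner)
  \<comment> \<open>Compactness of the product gives one subsequence for both \<open>v\<close> and
    \<open>n\<close>.\<close>
  have "compact (sphere (0::'a) 1 \<times> sphere (0::'b) 1)"
    by (intro compact_Times compact_sphere)
  moreover have "(v k, n k) \<in> sphere 0 1 \<times> sphere 0 1" for k
    using v1 n1 by simp
  ultimately obtain l r where l: "l \<in> sphere (0::'a) 1 \<times> sphere (0::'b) 1"
      and r: "strict_mono r" "((\<lambda>k. (v k, n k)) \<circ> r) \<longlonglongrightarrow> l"
    unfolding compact_def by (blast dest: spec[of _ "\<lambda>k. (v k, n k)"])
  define v0 n0 where "v0 = fst l" and "n0 = snd l"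
  have lv: "(\<lambda>k. v (r k)) \<longlonglongrightarrow> v0" and ln: "(\<lambda>k. n (r k)) \<longlonglongrightarrow> n0"
    using tendsto_fst[OF r(2)] tendsto_snd[OF r(2)] by (simp_all add: comp_def v0_def n0_def)
  have v01: "norm v0 = 1" and n01: "norm n0 = 1"
    using l by (auto simp: v0_def n0_def)
  have lsr: "(\<lambda>k. s (r k)) \<longlonglongrightarrow> xbar"
    using LIMSEQ_subseq_LIMSEQ[OF ls r(1)] by (simp add: comp_def)
  have "isCont h xbar"
    using der has_derivative_continuous by blast
  then have lh: "(\<lambda>k. h (s (r k))) \<longlonglongrightarrow> h xbar"
    using lsr isCont_tendsto_compose by blast
  have "isCont h' xbar"
    using h'_cont by (simp add: continuous_on_eq_continuous_at)
  then have lh': "(\<lambda>k. h' (s (r k))) \<longlonglongrightarrow> h' xbar"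
    using lsr isCont_tendsto_compose by blast
  have lr: "(\<lambda>k. inverse (real (Suc (r k)))) \<longlonglongrightarrow> 0"
    using LIMSEQ_subseq_LIMSEQ[OF LIMSEQ_inverse_real_of_nat r(1)] by (simp add: comp_def)
  have n0N: "n0 \<in> normal_cone K (h xbar)"
    using nN ln lh by (rule normal_cone_limit)
  have n0_flat: "n0 \<bullet> h' xbar u = 0" for u
  proof (rule LIMSEQ_unique)
    show "(\<lambda>k. n (r k) \<bullet> h' (s (r k)) u) \<longlonglongrightarrow> n0 \<bullet> h' xbar u"
      by (intro tendsto_intros ln lh')
    have "\<bar>n k \<bullet> h' (s k) u\<bar> \<le> inverse (real (Suc k)) * norm u" for k
    proof -
      \<comment> \<open>The multipliers blow up: pairing \<open>n k\<close> with \<open>v k\<close>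
        gives exactly \<open>inverse (norm (m k))\<close>, which \<open>small\<close>
        bounds.\<close>
      have "inverse (norm (m k)) \<le> inverse (real (Suc k))"
        using small[OF nN, of k] n1[of k] v1[of k]
        by (simp add: n_inner dot_square_norm del: of_nat_Suc)
      moreover have "\<bar>v k \<bullet> u\<bar> \<le> norm u"
        using Cauchy_Schwarz_ineq2[of "v k" u] v1 by simp
      ultimately show ?thesis
        unfolding n_inner abs_mult by (intro mult_mono) auto
    qed
    then show "(\<lambda>k. n (r k) \<bullet> h' (s (r k)) u) \<longlonglongrightarrow> 0"
      by (intro Lim_null_comparison[OF _ tendsto_mult_left_zero[OF lr, of "norm u"]]) auto
  qed
  \<comment> \<open>As the derivative vanishes at \<open>xbar\<close>, convexity makes 0 a global
    lower bound of \<open>n0 \<bullet> h\<close>; it is attained on all of \<open>S\<close>.\<close>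
  have n0_ge: "n0 \<bullet> h y \<ge> 0" for y
    using normal_inner_derivative_le[OF conc K(1,2) der hS[OF S(4)] n0N, of y] n0_flat by simp
  have n0K: "\<forall>k\<in>K. n0 \<bullet> k \<le> 0"
    using n0N normal_cone_of_cone_iff[OF K(1) hS[OF S(4)]] by blast
  have n0_eq: "n0 \<bullet> h y = 0" if "y \<in> S" for y
    using n0_ge[of y] n0K hS[OF that] by force
  have h0: "h (s k) = 0" for k
  proof (rule ccontr)
    assume nz: "h (s k) \<noteq> 0"
    have "n0 \<in> normal_cone K (h (s k))"
      using normal_cone_of_cone_iff[OF K(1) hS[OF sS]] n0K n0_eq[OF sS] by blast
    moreover have "n0 \<noteq> 0"
      using n01 by auto
    ultimately obtain c where c: "m k = c *\<^sub>R n0"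
      using smooth_cone_normals_parallel[OF smooth hS[OF sS] nz _ mN] by blast
    \<comment> \<open>\<open>s k\<close> is a global minimiser, so the derivative vanishes there,
      while its multiple given by \<open>m k\<close> takes the value 1 at
      \<open>v k\<close>.\<close>
    have "((\<lambda>y. n0 \<bullet> h y) has_derivative (\<lambda>u. n0 \<bullet> h' (s k) u)) (at (s k))"
      by (intro has_derivative_inner_right der)
    then have "(\<lambda>u. n0 \<bullet> h' (s k) u) = (\<lambda>u. 0)"
      by (rule differential_zero_maxmin[OF UNIV_I open_UNIV]) (use n0_ge n0_eq[OF sS] in auto)
    then have "m k \<bullet> h' (s k) (v k) = 0"
      unfolding c by (metis inner_scaleR_left mult_zero_right)
    then show False
      using m_inner[of k "v k"] v1[of k] by (simp add: dot_square_norm)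
  qed
  then have hx0: "h xbar = 0"
    using lh LIMSEQ_unique[OF tendsto_const] by fastforce
  have "v0 \<in> normal_cone S xbar"
    using vN lv lsr by (rule normal_cone_limit)
  then obtain q where q: "q \<in> normal_cone K 0" "v0 = adjoint (h' xbar) q"
    using ACQ[of xbar] S(4) U(2) hx0 by auto
  \<comment> \<open>The fixed \<open>q\<close> is normal to \<open>K\<close> at every
    \<open>h (s k) = 0\<close>, so \<open>small\<close> applies to it along the whole
    sequence.\<close>
  have "(\<lambda>k. q \<bullet> h' (s (r k)) (v (r k))) \<longlonglongrightarrow> q \<bullet> h' xbar v0"
    by (intro tendsto_intros lh' lv)
  moreover have "(\<lambda>k. norm q * inverse (real (Suc (r k)))) \<longlonglongrightarrow> 0"
    by (rule tendsto_mult_right_zero[OF lr])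
  ultimately have "q \<bullet> h' xbar v0 \<le> 0"
    by (rule LIMSEQ_le) (use small q(1) h0 in auto)
  moreover have "q \<bullet> h' xbar v0 = 1"
    using adj[of xbar q v0] v01 by (simp add: q(2)[symmetric] dot_square_norm)
  ultimately show False
    by simp
qed

theorem theorem2:
  fixes K :: "(real ^ 'm) set"
    and h :: "real ^ 'n \<Rightarrow> real ^ 'm"
    and h' :: "real ^ 'n \<Rightarrow> ((real ^ 'n) \<Rightarrow>\<^sub>L (real ^ 'm))"
    and S :: "(real ^ 'n) set"
    and xbar :: "real ^ 'n"
  assumes "smooth_cone K"
    and "\<And>x. (h has_derivative blinfun_apply (h' x)) (at x)"
    and "continuous_on UNIV h'"
    and "K_concave K h"
    and "S = {x. h x \<in> K}"
    and "S \<noteq> {}"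
    and "xbar \<in> S"
  shows "local_error_bound h K xbar \<longleftrightarrow>
    (\<exists>U. open U \<and> xbar \<in> U \<and>
       (\<forall>x\<in>S \<inter> U. adjoint (blinfun_apply (h' x)) ` normal_cone K (h x) = normal_cone S x))"
proof -
  have K: "cone K" "closed K" "convex K"
    using assms(1) unfolding smooth_cone_def regular_cone_def by auto
  have "continuous_on UNIV h"
    using assms(2) has_derivative_continuous continuous_at_imp_continuous_on by blast
  then have "closed S"
    using continuous_closed_preimage[of UNIV h K] K(2) by (simp add: assms(5) vimage_def)
  have "convex S"
    unfolding assms(5) by (rule convex_K_concave_preimage[OF assms(4) K(1,3)])
  show ?thesis
  proof
    assume "local_error_bound h K xbar"
    then obtain U \<alpha> where U: "open U" "xbar \<in> U" "\<alpha> > 0"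
        "\<And>x. x \<in> U \<Longrightarrow> infdist x S \<le> \<alpha> * infdist (h x) K"
      unfolding local_error_bound_def assms(5) by blast
    have "adjoint (h' x) ` normal_cone K (h x) = normal_cone S x" if "x \<in> S \<inter> U" for x
    proof
      show "adjoint (h' x) ` normal_cone K (h x) \<subseteq> normal_cone S x"
        unfolding assms(5) using that assms(5)
        by (intro adjoint_image_normal_cone_subset assms(2,4) K) auto
      show "normal_cone S x \<subseteq> adjoint (h' x) ` normal_cone K (h x)"
        using that U(3)
        by (intro error_bound_imp_normal_cone_subset[OF K assms(2,5) \<open>closed S\<close> _ U(1) _ _ U(4)]) auto
    qed
    then show "\<exists>U. open U \<and> xbar \<in> U \<and>
        (\<forall>x\<in>S \<inter> U. adjoint (h' x) ` normal_cone K (h x) = normal_cone S x)"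
      using U(1,2) by blast
  next
    assume "\<exists>U. open U \<and> xbar \<in> U \<and>
        (\<forall>x\<in>S \<inter> U. adjoint (h' x) ` normal_cone K (h x) = normal_cone S x)"
    then show "local_error_bound h K xbar"
      using normal_cone_subset_imp_error_bound[OF assms(1-5) \<open>closed S\<close> \<open>convex S\<close> assms(7)]
      by (metis order_refl)
  qed
qed

end
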